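(* Let $p$ be a bonding curve, let $a \ge 0$ be an assessment, and let $q$ be an allocative curve for $p$ (at assessment $a$). Let a tolerance $\varepsilon > 0$ and a share supply $S > 0$ be given. Then there are $\tau_-, \tau_+ \in (0,1)$ such that (i) for all $\tau \in [\tau_+, 1)$, the curve $s \mapsto q(s,a;\tau,p)$ is $\varepsilon$-allocatively efficient on $[0,S]$ (with respect to the assessment $a$); (ii) for all $\tau \in (0,\tau_-]$, the curve $s \mapsto q(s,a;\tau,p)$ is $(p-\varepsilon)$-investment efficient on $[0,S]$.
   Context: Bonding curve: a strictly increasing and continuous function $p\colon [0,\infty)\to\mathbb{R}$ with $p(0)=0$. Allocative curve: let $p$ be a bonding curve and $a \ge 0$ an assessment. A family of functions $s \mapsto q(s,a;\tau,p)$, $s \ge 0$, indexed by the tax rate $\tau\in(0,1)$, is an allocative curve for $p$ (at assessment $a$) if: 1. For every $S>0$, $q(\cdot,a;\tau,p) \to p$ uniformly on $[0,S]$ as $\tau\to 0^+$. 2. For every $s \ge 0$, $\lim_{\tau\to 1^-} q(s,a;\tau,p) \le a$ (the limit exists and is at most $a$). 3. For each $\tau \in (0,1)$, $q(\cdot,a;\tau,p)$ is a bonding curve (continuous, strictly increasing, vanishing at $0$), and if $a>0$ it is bounded: there is $B>0$ (possibly depending on $a$ and $\tau$) with $q(s,a;\tau,p)\le B$ for all $s\ge 0$. Investment efficiency: for a reference function $e\colon[0,\infty)\to\mathbb{R}$ and $S>0$, a bonding curve $r$ is $e$-investment efficient on $[0,S]$ if $e(s)\le r(s)$ for all $s\in[0,S]$.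 Here $p-\varepsilon$ denotes the function $s\mapsto p(s)-\varepsilon$. Allocative efficiency: for a tolerance $\varepsilon>0$, an assessment $a\ge 0$ and $S>0$, a bonding curve $r$ is $\varepsilon$-allocatively efficient on $[0,S]$ if $r(s)\le a+\varepsilon$ for all $s\in[0,S]$. *)

theory Defs
  imports "HOL-Analysis.Analysis"
begin

(* Functions on [0, \<infinity>) are total functions on the reals of which only the values on {0..} are
   ever constrained or used. *)

definition bonding_curve :: "(real \<Rightarrow> real) \<Rightarrow> bool" where
  "bonding_curve p \<longleftrightarrow> continuous_on {0..} p \<and> strict_mono_on {0..} p \<and> p 0 = 0"

(* q \<tau> s stands for q(s, a; \<tau>, p), with a and p held fixed. Values of q at tax rates outside (0, 1)
   are irrelevant: both one-sided limits depend only on rates close to 0 or 1 within (0, 1). *)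

definition allocative_curve :: "(real \<Rightarrow> real) \<Rightarrow> real \<Rightarrow> (real \<Rightarrow> real \<Rightarrow> real) \<Rightarrow> bool" where
  "allocative_curve p a q \<longleftrightarrow>
     (\<forall>S>0. uniform_limit {0..S} q p (at_right 0)) \<and>
     (\<forall>s\<ge>0. \<exists>l\<le>a. ((\<lambda>\<tau>. q \<tau> s) \<longlongrightarrow> l) (at_left 1)) \<and>
     (\<forall>\<tau>\<in>{0<..<1}. bonding_curve (q \<tau>) \<and> (a > 0 \<longrightarrow> (\<exists>B>0. \<forall>s\<ge>0. q \<tau> s \<le> B)))"

(* Both efficiency notions are properties of bonding curves. *)

definition investment_efficient :: "(real \<Rightarrow> real) \<Rightarrow> real \<Rightarrow> (real \<Rightarrow> real) \<Rightarrow> bool" where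
  "investment_efficient e S r \<longleftrightarrow> bonding_curve r \<and> (\<forall>s\<in>{0..S}. e s \<le> r s)"

definition allocatively_efficient :: "real \<Rightarrow> real \<Rightarrow> real \<Rightarrow> (real \<Rightarrow> real) \<Rightarrow> bool" where
  "allocatively_efficient \<epsilon> a S r \<longleftrightarrow> bonding_curve r \<and> (\<forall>s\<in>{0..S}. r s \<le> a + \<epsilon>)"

end

theory Submission
  imports Defs
begin

text \<open>
  The two claims come from opposite ends of the range of tax rates.

  Near \<open>\<tau> = 1\<close> only pointwise convergence is available, but monotonicity makes the single point
  \<open>S\<close> enough: \<open>q \<tau> s \<le> q \<tau> S\<close> on \<open>{0..S}\<close>, and \<open>q \<tau> S\<close> tends to a limit \<open>\<le> a < a + \<epsilon>\<close>, so it is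
  eventually below \<open>a + \<epsilon>\<close>.

  Near \<open>\<tau> = 0\<close> the convergence to \<open>p\<close> is uniform on \<open>{0..S}\<close>, so eventually
  \<open>\<bar>q \<tau> s - p s\<bar> < \<epsilon>\<close> for all \<open>s\<close> in \<open>{0..S}\<close> at once, and one half of this bound is the claim.
\<close>

text \<open>
  The next two lemmas shrink the open neighbourhood that a one-sided filter provides, so that the
  threshold itself satisfies the property and lies strictly between 0 and 1.
\<close>

lemma eventually_at_left_1_threshold:
  fixes P :: "real \<Rightarrow> bool"
  assumes "eventually P (at_left 1)"
  shows "\<exists>t\<in>{0<..<1}. \<forall>\<tau>\<in>{t..<1}. P \<tau>"
proof -
  obtain b where b: "b < 1" "\<And>\<tau>. b < \<tau> \<Longrightarrow> \<tau> < 1 \<Longrightarrow> P \<tau>"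
    using assms eventually_at_left[of "0::real" 1 P] by auto
  show ?thesis
    by (rule bexI[of _ "max (1/2) ((b + 1) / 2)"]) (use b in auto)
qed

lemma eventually_at_right_0_threshold:
  fixes P :: "real \<Rightarrow> bool"
  assumes "eventually P (at_right 0)"
  shows "\<exists>t\<in>{0<..<1}. \<forall>\<tau>\<in>{0<..t}. P \<tau>"
proof -
  obtain b where b: "0 < b" "\<And>\<tau>. 0 < \<tau> \<Longrightarrow> \<tau> < b \<Longrightarrow> P \<tau>"
    using assms eventually_at_right[of "0::real" 1 P] by auto
  show ?thesis
    by (rule bexI[of _ "min (1/2) (b / 2)"]) (use b in auto)
qed

lemma allocatively_efficient_iff_endpoint:
  assumes "S \<ge> 0"
  shows "allocatively_efficient \<epsilon> a S r \<longleftrightarrow> bonding_curve r \<and> r S \<le> a + \<epsilon>"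
proof -
  have "r s \<le> r S" if "bonding_curve r" "s \<in> {0..S}" for s
    using that strict_mono_on_leD[of "{0..}" r s S] by (auto simp: bonding_curve_def)
  then show ?thesis
    using assms unfolding allocatively_efficient_def by fastforce
qed

theorem lemma3p1:
  fixes p :: "real \<Rightarrow> real" and a :: real and q :: "real \<Rightarrow> real \<Rightarrow> real" and \<epsilon> S :: real
  assumes "bonding_curve p"
    and "a \<ge> 0"
    and "allocative_curve p a q"
    and "\<epsilon> > 0"
    and "S > 0"
  shows "\<exists>\<tau>\<^sub>m\<in>{0<..<1}. \<exists>\<tau>\<^sub>p\<in>{0<..<1}.
           (\<forall>\<tau>\<in>{\<tau>\<^sub>p..<1}. allocatively_efficient \<epsilon> a S (q \<tau>)) \<and>
           (\<forall>\<tau>\<in>{0<..\<tau>\<^sub>m}. investment_efficient (\<lambda>s. p s - \<epsilon>) S (q \<tau>))"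
proof -
  have curve: "bonding_curve (q \<tau>)" if "\<tau> \<in> {0<..<1}" for \<tau>
    using assms(3) that by (auto simp: allocative_curve_def)
  obtain l where l: "l \<le> a" "((\<lambda>\<tau>. q \<tau> S) \<longlongrightarrow> l) (at_left 1)"
    using assms(3,5) unfolding allocative_curve_def by (meson less_imp_le)
  have "eventually (\<lambda>\<tau>. q \<tau> S < a + \<epsilon>) (at_left 1)"
    using order_tendstoD(2)[OF l(2)] l(1) assms(4) by simp
  then obtain tp where tp: "tp \<in> {0<..<1}" "\<And>\<tau>. \<tau> \<in> {tp..<1} \<Longrightarrow> q \<tau> S < a + \<epsilon>"
    using eventually_at_left_1_threshold by blast
  have "uniform_limit {0..S} q p (at_right 0)"
    using assms(3,5) by (auto simp: allocative_curve_def)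
  then have "eventually (\<lambda>\<tau>. \<forall>s\<in>{0..S}. dist (q \<tau> s) (p s) < \<epsilon>) (at_right 0)"
    using assms(4) by (rule uniform_limitD)
  then obtain tm where tm: "tm \<in> {0<..<1}"
    "\<And>\<tau>. \<tau> \<in> {0<..tm} \<Longrightarrow> \<forall>s\<in>{0..S}. dist (q \<tau> s) (p s) < \<epsilon>"
    using eventually_at_right_0_threshold by blast
  have "allocatively_efficient \<epsilon> a S (q \<tau>)" if "\<tau> \<in> {tp..<1}" for \<tau>
    using tp(2)[OF that] curve[of \<tau>] that tp(1) assms(5)
    by (simp add: allocatively_efficient_iff_endpoint)
  moreover have "investment_efficient (\<lambda>s. p s - \<epsilon>) S (q \<tau>)" if "\<tau> \<in> {0<..tm}" for \<tau>
    using tm(2)[OF that] curve[of \<tau>] that tm(1)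
    by (force simp: investment_efficient_def dist_real_def)
  ultimately show ?thesis
    using tm(1) tp(1) by blast
qed

end
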